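(* Let $\mathcal P,\mathcal Q,\mathcal R$ be $2\times2$ matrices whose entries are continuous complex-valued functions on $[a,b]$, with $\det\mathcal P(x)\neq0$ for all $x\in[a,b]$, and let $\lambda\in\mathbb{C}$. Let $B=\begin{pmatrix}0&1\\-1&0\end{pmatrix}$, $Q=B\mathcal P^{-1}\mathcal Q$, $R=B\mathcal P^{-1}\mathcal R$, and $$w(x)=\exp\Bigl(\frac12\int\operatorname{tr}\bigl(BQ(s)\bigr)\,ds\Bigr).$$ Then, under the substitution $Y=w(x)U$, the system $$\mathcal P(x)\frac{dY}{dx}+\mathcal Q(x)Y=\lambda\mathcal R(x)Y,\qquad x\in[a,b],$$ is transformed to the system $$B\frac{dU}{dx}+\Bigl(Q(x)+\frac12\operatorname{tr}\bigl(BQ(x)\bigr)\,B\Bigr)U=\lambda R(x)U,\qquad x\in[a,b]$$ (that is, $Y=wU$ solves the former if and only if $U$ solves the latter), and the matrix $Q(x)+\frac12\operatorname{tr}(BQ(x))B$ satisfies $$\operatorname{tr}\Bigl(B\bigl(Q(x)+\tfrac12\operatorname{tr}(BQ(x))\,B\bigr)\Bigr)=0\quad\text{for all }x\in[a,b],$$ so it is symmetric and the transformed system is of the form $B\,U'+P(x)U=\lambda R(x)U$ with a symmetric matrix $P$.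
   Context: $Y$ and $U$ denote unknown continuously differentiable functions $[a,b]\to\mathbb{C}^2$; $\int\operatorname{tr}(BQ(s))\,ds$ denotes an antiderivative on $[a,b]$ of the continuous function $\operatorname{tr}(BQ(x))$ (any fixed one). *)

theory Defs
  imports "HOL-Analysis.Analysis"
begin

definition B :: "complex^2^2" where
  "B = vector [vector [0, 1], vector [-1, 0]]"

definition scale_matrix :: "complex \<Rightarrow> complex^2^2 \<Rightarrow> complex^2^2" (infixr "*\<^sub>M" 75) where
  "c *\<^sub>M A = (\<chi> i j. c * A $ i $ j)"

(* C1_differentiable_on is not used for this: it requires two-sided derivatives at a and b. *)
definition C1_on_interval :: "real \<Rightarrow> real \<Rightarrow> (real \<Rightarrow> complex^2) \<Rightarrow> bool" where
  "C1_on_interval a b Y \<longleftrightarrow>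
     (\<exists>Y'. continuous_on {a..b} Y' \<and>
           (\<forall>x\<in>{a..b}. (Y has_vector_derivative Y' x) (at x within {a..b})))"

definition solves_system ::
  "real \<Rightarrow> real \<Rightarrow> (real \<Rightarrow> complex^2^2) \<Rightarrow> (real \<Rightarrow> complex^2^2) \<Rightarrow> (real \<Rightarrow> complex^2^2)
     \<Rightarrow> complex \<Rightarrow> (real \<Rightarrow> complex^2) \<Rightarrow> bool" where
  "solves_system a b P Q R lam Y \<longleftrightarrow>
     C1_on_interval a b Y \<and>
     (\<forall>x\<in>{a..b}. P x *v vector_derivative Y (at x within {a..b}) + Q x *v Y x
                 = (lam *\<^sub>M R x) *v Y x)"

end

theory Submission
  imports Defs
begin

text \<open>
  Multiplying the system by \<open>B \<P>\<^sup>-\<^sup>1\<close> gives \<open>B Y' + Q Y = \<lambda> R Y\<close>. Since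
  \<open>w' = 1/2 tr (B Q) w\<close>, the substitution \<open>Y = w U\<close> adds the term \<open>1/2 tr (B Q) B\<close> to the potential
  after division by \<open>w\<close>; as \<open>B\<^sup>2 = -1\<close>, this cancels \<open>tr (B Q)\<close>. Continuity of \<open>\<P>\<close> and \<open>\<Q>\<close> is needed
  to make \<open>w\<close> and \<open>1/w\<close> continuously differentiable, so that \<open>Y\<close> and \<open>U\<close> are so simultaneously.
\<close>

lemma continuous_on_det:
  fixes A :: "'a::topological_space \<Rightarrow> complex^'n^'n"
  assumes "\<And>i j. continuous_on S (\<lambda>x. A x $ i $ j)"
  shows "continuous_on S (\<lambda>x. det (A x))"
  unfolding det_def by (intro continuous_intros assms)

lemma matrix_inv_inverse:
  fixes A :: "'a::semiring_1^'n^'m"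
  assumes "invertible A"
  shows "A ** matrix_inv A = mat 1 \<and> matrix_inv A ** A = mat 1"
  using assms unfolding invertible_def matrix_inv_def by (rule someI_ex)

text \<open>Column \<open>l\<close> of the inverse solves the linear system with right-hand side
  \<open>axis l 1\<close>, so Cramer's rule applies. As quotients of determinants, the entries of
  the inverse visibly depend continuously on those of \<open>A\<close>.\<close>

lemma matrix_inv_cramer:
  fixes A :: "complex^'n^'n"
  assumes "det A \<noteq> 0"
  shows "matrix_inv A $ k $ l
           = det (\<chi> i j. if j = k then axis l 1 $ i else A $ i $ j) / det A"
proof -
  have "A *v (matrix_inv A *v axis l 1) = axis l 1"
    using assms by (simp add: matrix_vector_mul_assoc matrix_inv_inverse invertible_det_nz)
  then have "matrix_inv A *v axis l 1
      = (\<chi> k. det (\<chi> i j. if j = k then axis l 1 $ i else A $ i $ j) / det A)"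
    using cramer[OF assms] by blast
  then have "(matrix_inv A *v axis l 1) $ k
      = det (\<chi> i j. if j = k then axis l 1 $ i else A $ i $ j) / det A"
    by simp
  moreover have "(matrix_inv A *v axis l 1) $ k = matrix_inv A $ k $ l"
    by (simp add: matrix_vector_mult_def axis_def if_distrib cong: if_cong)
  ultimately show ?thesis
    by simp
qed

lemma continuous_on_matrix_inv:
  fixes A :: "'a::topological_space \<Rightarrow> complex^'n^'n"
  assumes "\<And>i j. continuous_on S (\<lambda>x. A x $ i $ j)"
    and "\<And>x. x \<in> S \<Longrightarrow> det (A x) \<noteq> 0"
  shows "continuous_on S (\<lambda>x. matrix_inv (A x) $ k $ l)"
proof -
  have "continuous_on S
      (\<lambda>x. det (\<chi> i j. if j = k then axis l 1 $ i else A x $ i $ j) / det (A x))"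
  proof (intro continuous_on_divide continuous_on_det assms)
    fix i j
    show "continuous_on S
        (\<lambda>x. (\<chi> i j. if j = k then axis l 1 $ i else A x $ i $ j) $ i $ j)"
      using assms(1) by (cases "j = k") simp_all
  qed (use assms(2) in auto)
  then show ?thesis
    by (rule continuous_on_eq) (simp add: matrix_inv_cramer assms(2))
qed

lemma continuous_on_matrix_mult:
  fixes A C :: "'a::topological_space \<Rightarrow> complex^'n^'n"
  assumes "\<And>i j. continuous_on S (\<lambda>x. A x $ i $ j)"
    and "\<And>i j. continuous_on S (\<lambda>x. C x $ i $ j)"
  shows "continuous_on S (\<lambda>x. (A x ** C x) $ i $ j)"
  unfolding matrix_matrix_mult_def by (simp, intro continuous_intros assms)

text \<open>Bilinear maps on finite-dimensional spaces are bounded. This provides the product rule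
  and continuity for scaling by complex numbers.\<close>

lemma bounded_bilinear_vector_smult:
  "bounded_bilinear ((*s) :: complex \<Rightarrow> complex^'n \<Rightarrow> complex^'n)"
  unfolding bilinear_conv_bounded_bilinear[symmetric]
  by (auto simp: bilinear_def vec_eq_iff algebra_simps intro!: linearI)

text \<open>This is the product rule. It serves both directions of the substitution, with
  \<open>c\<close> being \<open>w\<close> or its reciprocal.\<close>

lemma C1_on_interval_smult:
  assumes Y: "C1_on_interval a b Y"
    and Z: "\<And>x. x \<in> {a..b} \<Longrightarrow> Z x = c x *s Y x"
    and c: "\<And>x. x \<in> {a..b} \<Longrightarrow> (c has_vector_derivative c' x) (at x within {a..b})"
    and c': "continuous_on {a..b} c'"
  shows "C1_on_interval a b Z"
proof -
  interpret bounded_bilinear "(*s) :: complex \<Rightarrow> complex^2 \<Rightarrow> complex^2"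
    by (rule bounded_bilinear_vector_smult)
  obtain Y' where Y': "continuous_on {a..b} Y'"
    and dY: "\<And>x. x \<in> {a..b} \<Longrightarrow> (Y has_vector_derivative Y' x) (at x within {a..b})"
    using Y unfolding C1_on_interval_def by blast
  have "continuous_on {a..b} c" "continuous_on {a..b} Y"
    using c dY by (blast intro: continuous_on_vector_derivative)+
  then have "continuous_on {a..b} (\<lambda>x. c x *s Y' x + c' x *s Y x)"
    by (intro continuous_on_add continuous_on c' Y')
  moreover have "(Z has_vector_derivative c x *s Y' x + c' x *s Y x) (at x within {a..b})"
    if "x \<in> {a..b}" for x
    using Z has_vector_derivative[OF c[OF that] dY[OF that]]
    by (rule has_vector_derivative_transform[OF that])
  ultimately show ?thesis
    unfolding C1_on_interval_def by blast
qed

text \<open>Since \<open>a < b\<close>, derivatives within the interval are unique, also at the end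
  points, so the product rule determines the value chosen by
  \<open>vector_derivative\<close>.\<close>

lemma vector_derivative_smult:
  assumes "a < b" and x: "x \<in> {a..b}"
    and Y: "C1_on_interval a b Y"
    and Z: "\<And>x. x \<in> {a..b} \<Longrightarrow> Z x = c x *s Y x"
    and c: "(c has_vector_derivative c') (at x within {a..b})"
  shows "vector_derivative Z (at x within {a..b})
           = c x *s vector_derivative Y (at x within {a..b}) + c' *s Y x"
proof -
  interpret bounded_bilinear "(*s) :: complex \<Rightarrow> complex^2 \<Rightarrow> complex^2"
    by (rule bounded_bilinear_vector_smult)
  have "(Y has_vector_derivative vector_derivative Y (at x within {a..b})) (at x within {a..b})"
    using Y x unfolding C1_on_interval_def
    by (metis differentiableI_vector vector_derivative_works)
  with Z have "(Z has_vector_derivative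
      c x *s vector_derivative Y (at x within {a..b}) + c' *s Y x) (at x within {a..b})"
    by (intro has_vector_derivative_transform[OF x _ has_vector_derivative[OF c]])
  then show ?thesis
    by (rule vector_derivative_within_closed_interval[OF assms(1) x])
qed

lemma B_nth: "B $ 1 $ 1 = 0" "B $ 1 $ 2 = 1" "B $ 2 $ 1 = -1" "B $ 2 $ 2 = 0"
  by (simp_all add: B_def)

lemma det_B: "det B = 1"
  by (simp add: det_2 B_nth)

lemma scale_matrix_nth: "(c *\<^sub>M A) $ i $ j = c * A $ i $ j"
  by (simp add: scale_matrix_def)

lemma scale_matrix_mult_vec: "(c *\<^sub>M A) *v v = c *s (A *v v)"
  by (simp add: vec_eq_iff matrix_vector_mult_def scale_matrix_def sum_distrib_left mult.assoc)

lemma matrix_mult_scale_matrix: "C ** (c *\<^sub>M A) = c *\<^sub>M (C ** A)"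
  by (simp add: vec_eq_iff matrix_matrix_mult_def scale_matrix_def sum_distrib_left mult.left_commute)

lemma matrix_vector_mult_eq_iff:
  fixes M :: "complex^'n^'n"
  assumes "det M \<noteq> 0"
  shows "M *v u = M *v v \<longleftrightarrow> u = v"
  using assms by (metis invertible_det_nz inj_matrix_vector_mult injD)

text \<open>The factor \<open>1/2\<close> fits dimension two, where
  \<open>trace (B ** B) = -2\<close>.\<close>

lemma trace_B_mult_correction:
  "trace (B ** (A + (1/2 * trace (B ** A)) *\<^sub>M B)) = 0"
  by (simp add: trace_def sum_2 matrix_matrix_mult_def scale_matrix_nth B_nth algebra_simps)

text \<open>The trace equals \<open>A $ 2 $ 1 - A $ 1 $ 2\<close>.\<close>

lemma symmetric_iff_trace_B_mult:
  "transpose A = A \<longleftrightarrow> trace (B ** A) = 0"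
  by (auto simp: trace_def sum_2 matrix_matrix_mult_def B_nth vec_eq_iff transpose_def forall_2)

text \<open>The algebra at a single point: \<open>u\<close> and \<open>v\<close> stand for the
  values of \<open>U\<close> and its derivative, and \<open>t * w\<close> for the derivative of the
  factor \<open>w\<close>, so that \<open>w *s v + (t * w) *s u\<close> is the derivative of
  \<open>Y\<close>.\<close>

lemma pointwise_system_iff:
  fixes P Q R :: "complex^2^2"
  assumes P: "det P \<noteq> 0" and w: "w \<noteq> 0"
  shows "P *v (w *s v + (t * w) *s u) + Q *v (w *s u) = (lam *\<^sub>M R) *v (w *s u)
     \<longleftrightarrow> B *v v + (B ** matrix_inv P ** Q + t *\<^sub>M B) *v u
          = (lam *\<^sub>M (B ** matrix_inv P ** R)) *v u"
    (is "?l = ?r \<longleftrightarrow> ?l' = ?r'")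
proof -
  define M where "M = B ** matrix_inv P"
  have MP: "M ** P = B"
    using P by (simp add: M_def matrix_mul_assoc[symmetric] matrix_inv_inverse invertible_det_nz)
  \<comment> \<open>Invertibility of \<open>M\<close> makes multiplication by it an equivalence
    rather than only an implication.\<close>
  then have "det M * det P = 1"
    by (metis det_B det_mul)
  then have M: "det M \<noteq> 0"
    by auto
  have "M *v ?l = w *s ?l'"
    by (simp add: M_def[symmetric] matrix_vector_right_distrib matrix_vector_mul_assoc MP
        matrix_vector_mult_add_rdistrib scale_matrix_mult_vec vector_scalar_commute[symmetric]
        vec.scale_right_distrib mult.commute)
  moreover have "M *v ?r = w *s ?r'"
    by (simp add: M_def[symmetric] matrix_vector_mul_assoc matrix_mult_scale_matrix
        vector_scalar_commute[symmetric])
  ultimately show ?thesis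
    using matrix_vector_mult_eq_iff[OF M, of ?l ?r] w by (metis vector_mul_lcancel)
qed

theorem mainTheorem3:
  fixes a b :: real
    and \<P> \<Q> \<R> Q R :: "real \<Rightarrow> complex^2^2"
    and lam :: complex
    and F w :: "real \<Rightarrow> complex"
  assumes "a < b"
    and "\<And>i j. continuous_on {a..b} (\<lambda>x. \<P> x $ i $ j)"
    and "\<And>i j. continuous_on {a..b} (\<lambda>x. \<Q> x $ i $ j)"
    and "\<And>i j. continuous_on {a..b} (\<lambda>x. \<R> x $ i $ j)"
    and "\<And>x. x \<in> {a..b} \<Longrightarrow> det (\<P> x) \<noteq> 0"
    and "\<And>x. x \<in> {a..b} \<Longrightarrow> Q x = B ** matrix_inv (\<P> x) ** \<Q> x"
    and "\<And>x. x \<in> {a..b} \<Longrightarrow> R x = B ** matrix_inv (\<P> x) ** \<R> x"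
    and "\<And>x. x \<in> {a..b} \<Longrightarrow> (F has_vector_derivative trace (B ** Q x)) (at x within {a..b})"
    and "\<And>x. x \<in> {a..b} \<Longrightarrow> w x = exp (1/2 * F x)"
  shows "(\<forall>Y U. (\<forall>x\<in>{a..b}. Y x = w x *s U x) \<longrightarrow>
            (solves_system a b \<P> \<Q> \<R> lam Y \<longleftrightarrow>
             solves_system a b (\<lambda>x. B) (\<lambda>x. Q x + (1/2 * trace (B ** Q x)) *\<^sub>M B) R lam U))
       \<and> (\<forall>x\<in>{a..b}. trace (B ** (Q x + (1/2 * trace (B ** Q x)) *\<^sub>M B)) = 0)
       \<and> (\<forall>x\<in>{a..b}. transpose (Q x + (1/2 * trace (B ** Q x)) *\<^sub>M B)
                      = Q x + (1/2 * trace (B ** Q x)) *\<^sub>M B)"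
proof (intro conjI allI impI ballI)
  let ?t = "\<lambda>x. trace (B ** Q x)"
  have t: "continuous_on {a..b} (\<lambda>x. 1/2 * ?t x)"
  proof -
    \<comment> \<open>Continuity is proved for the formula defining \<open>Q\<close> and then
      transferred, as \<open>Q\<close> is prescribed only on the interval.\<close>
    have "continuous_on {a..b} (\<lambda>x. trace (B ** (B ** matrix_inv (\<P> x) ** \<Q> x)))"
      unfolding trace_def
      by (intro continuous_on_sum continuous_on_matrix_mult continuous_on_matrix_inv
          continuous_on_const assms)
    then have "continuous_on {a..b} ?t"
      by (rule continuous_on_eq) (simp add: assms(6))
    then show ?thesis
      by (intro continuous_intros)
  qed
  \<comment> \<open>The constant \<open>k\<close> will be \<open>1/2\<close> for \<open>w\<close>
    and \<open>- 1/2\<close> for its reciprocal.\<close>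
  have exp_deriv: "(g has_vector_derivative k * ?t x * g x) (at x within {a..b})"
    if g: "\<And>x. x \<in> {a..b} \<Longrightarrow> g x = exp (k * F x)" and x: "x \<in> {a..b}" for g k x
  proof -
    have "((\<lambda>x. k * F x) has_vector_derivative k * ?t x) (at x within {a..b})"
      by (intro has_vector_derivative_mult_right assms(8) x)
    from field_vector_diff_chain_within[OF this DERIV_subset[OF DERIV_exp subset_UNIV]]
    have "(exp \<circ> (\<lambda>x. k * F x) has_vector_derivative k * ?t x * exp (k * F x))
        (at x within {a..b})"
      by simp
    then show ?thesis
      using has_vector_derivative_transform[OF x, of g "exp \<circ> (\<lambda>x. k * F x)"] x g by simp
  qed
  have w: "(w has_vector_derivative 1/2 * ?t x * w x) (at x within {a..b})" if "x \<in> {a..b}" for x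
    using exp_deriv assms(9) that by blast
  \<comment> \<open>On the interval \<open>v\<close> is the reciprocal of \<open>w\<close>; it
    recovers \<open>U\<close> from \<open>Y\<close>.\<close>
  define v where "v x = exp (- 1/2 * F x)" for x
  have v: "(v has_vector_derivative - 1/2 * ?t x * v x) (at x within {a..b})" if "x \<in> {a..b}" for x
    using exp_deriv[of v] that v_def by blast
  have vw: "v x * w x = 1" if "x \<in> {a..b}" for x
    using that by (simp add: v_def assms(9) flip: exp_add)
  fix Y U :: "real \<Rightarrow> complex^2"
  assume Y: "\<forall>x\<in>{a..b}. Y x = w x *s U x"
  then have U: "U x = v x *s Y x" if "x \<in> {a..b}" for x
    using that by (simp add: vw)
  have wc: "continuous_on {a..b} (\<lambda>x. 1/2 * ?t x * w x)"
    using w by (intro continuous_on_mult[OF t] continuous_on_vector_derivative)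
  have vc: "continuous_on {a..b} (\<lambda>x. - 1/2 * ?t x * v x)"
  proof (intro continuous_on_mult[of _ "\<lambda>x. - 1/2 * ?t x"])
    show "continuous_on {a..b} (\<lambda>x. - 1/2 * ?t x)"
      using continuous_on_minus[OF t] by simp
  qed (use v in \<open>rule continuous_on_vector_derivative\<close>)
  have C1: "C1_on_interval a b Y \<longleftrightarrow> C1_on_interval a b U"
    using C1_on_interval_smult[OF _ _ w wc, of U Y] C1_on_interval_smult[OF _ U v vc] Y by blast
  \<comment> \<open>The equations are compared only for continuously differentiable
    \<open>U\<close>, where \<open>vector_derivative\<close> is a genuine derivative. By
    \<open>C1\<close> this regularity is part of both sides of the final equivalence.\<close>
  have "\<P> x *v vector_derivative Y (at x within {a..b}) + \<Q> x *v Y x = (lam *\<^sub>M \<R> x) *v Y x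
    \<longleftrightarrow> B *v vector_derivative U (at x within {a..b}) + (Q x + (1/2 * ?t x) *\<^sub>M B) *v U x
        = (lam *\<^sub>M R x) *v U x"
    if "C1_on_interval a b U" and x: "x \<in> {a..b}" for x
  proof -
    have "vector_derivative Y (at x within {a..b})
        = w x *s vector_derivative U (at x within {a..b}) + (1/2 * ?t x * w x) *s U x"
      using vector_derivative_smult[OF assms(1) x that(1) _ w[OF x]] Y by blast
    moreover have "w x \<noteq> 0"
      using vw[OF x] by auto
    ultimately show ?thesis
      using pointwise_system_iff[OF assms(5)[OF x], of "w x"
          "vector_derivative U (at x within {a..b})" "1/2 * ?t x" "U x" "\<Q> x" lam "\<R> x"]
        Y x assms(6,7) by simp
  qed
  then show "solves_system a b \<P> \<Q> \<R> lam Y \<longleftrightarrow>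
      solves_system a b (\<lambda>x. B) (\<lambda>x. Q x + (1/2 * ?t x) *\<^sub>M B) R lam U"
    unfolding solves_system_def using C1 by blast
\<comment> \<open>Symmetry is rewritten as the vanishing of the trace, so one identity settles both
  remaining claims.\<close>
qed (simp_all only: symmetric_iff_trace_B_mult trace_B_mult_correction)

end
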